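(* Let $X$ be a separable metric space with $\mathsf{tp}_{\mathsf{S}_1(\mathcal{O},\mathcal{O})}(X)<\omega^2$, and let $Y$ be a separable metric space. (1) If $Y$ has both $\mathsf{S}_c(\mathcal{O},\mathcal{O})$ and $\mathsf{S}_{fin}(\Omega,\mathcal{O}^{gp})$, then $X\times Y$ has $\mathsf{S}_c(\mathcal{O},\mathcal{O})$. (2) If $Y$ has $\mathsf{S}_{fin}(\Omega,\mathcal{O}^{gp})$, then $X\times Y$ has $\mathsf{S}_{fin}(\mathcal{O},\mathcal{O})$. (3) If $Y$ has $\mathsf{S}_1(\Omega,\mathcal{O}^{gp})$, then $X\times Y$ has $\mathsf{S}_1(\mathcal{O},\mathcal{O})$.
   Context: All topological spaces are separable metric spaces; $X\times Y$ carries the product topology. Covers. For a topological space $Z$: $\mathcal{O}$ denotes the collection of all open covers of $Z$. An open cover $\mathcal{U}$ of $Z$ is an $\omega$-cover if $Z\notin\mathcal{U}$ and for each finite $F\subset Z$ there is $U\in\mathcal{U}$ with $F\subset U$; $\Omega$ denotes the collection of all $\omega$-covers of $Z$. An open cover $\mathcal{U}$ of $Z$ is groupable if there is a partition $\mathcal{U}=\bigcup_{n\in\mathbb{N}}\mathcal{U}_n$ into pairwise disjoint finite sets $\mathcal{U}_n$ such that each element of $Z$ is in all but finitely many of the sets $\bigcup\mathcal{U}_n$; $\mathcal{O}^{gp}$ denotes the collection of all groupable open covers of $Z$. Selection principles. Let $\mathcal{A},\mathcal{B}$ be collections of open covers of $Z$. $\mathsf{S}_c(\mathcal{A},\mathcal{B})$: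 for each sequence $(O_m:m<\infty)$ of elements of $\mathcal{A}$ there is a sequence $(T_m:m<\infty)$ with each $T_m$ a pairwise disjoint family refining $O_m$ (each member of $T_m$ is contained in some member of $O_m$), and $\bigcup\{T_m:m<\infty\}\in\mathcal{B}$. $\mathsf{S}_{fin}(\mathcal{A},\mathcal{B})$: for each sequence $(O_m:m<\infty)$ of elements of $\mathcal{A}$ there is a sequence $(T_m:m<\infty)$ with each $T_m$ a finite subset of $O_m$, and $\bigcup\{T_m:m<\infty\}\in\mathcal{B}$. $\mathsf{S}_1(\mathcal{A},\mathcal{B})$: for each sequence $(O_m:m<\infty)$ of elements of $\mathcal{A}$ there is a sequence $(T_m:m<\infty)$ with each $T_m\in O_m$, and $\{T_m:m<\infty\}\in\mathcal{B}$. "$Z$ has" such a property means that it holds for the corresponding collections of covers of $Z$. Game and type. For an ordinal $\alpha$, $\mathsf{G}_1^{\alpha}(\mathcal{A},\mathcal{B})$ is the two-player game with $\alpha$ innings in which, in inning $\gamma<\alpha$, ONE first chooses $O_\gamma\in\mathcal{A}$ and then TWO responds with $T_\gamma\in O_\gamma$; TWO wins the play if $\{T_\gamma:\gamma<\alpha\}\in\mathcal{B}$, and otherwise ONE wins. $\mathsf{tp}_{\mathsf{S}_1(\mathcal{O},\mathcal{O})}(X)$ is the least ordinal $\alpha$ such that TWO has a winning strategy in $\mathsf{G}_1^{\alpha}(\mathcal{O},\mathcal{O})$ played on $X$. Here $\omega^2$ is the ordinal power. *)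

theory Defs
  imports "HOL-Analysis.Analysis" "HOL-Library.Disjoint_Sets" "HOL-Library.FuncSet"
begin

unbundle cardinal_syntax

definition open_covers :: "'a topology \<Rightarrow> 'a set set set" where
  "open_covers Z = {\<U>. (\<forall>U\<in>\<U>. openin Z U) \<and> \<Union>\<U> = topspace Z}"

definition omega_covers :: "'a topology \<Rightarrow> 'a set set set" where
  "omega_covers Z = {\<U> \<in> open_covers Z. topspace Z \<notin> \<U> \<and>
     (\<forall>F. finite F \<and> F \<subseteq> topspace Z \<longrightarrow> (\<exists>U\<in>\<U>. F \<subseteq> U))}"

text \<open>The blocks of the partition may be empty. On a nonempty space only finitely many of them
  can be, so a groupable cover of a nonempty space is infinite.\<close>

definition groupable_covers :: "'a topology \<Rightarrow> 'a set set set" where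
  "groupable_covers Z = {\<U> \<in> open_covers Z. \<exists>\<V> :: nat \<Rightarrow> 'a set set.
     \<U> = (\<Union>n. \<V> n) \<and> disjoint_family \<V> \<and> (\<forall>n. finite (\<V> n)) \<and>
     (\<forall>z\<in>topspace Z. finite {n. z \<notin> \<Union>(\<V> n)})}"

definition S_c :: "'a set set set \<Rightarrow> 'a set set set \<Rightarrow> bool" where
  "S_c \<A> \<B> \<longleftrightarrow> (\<forall>\<U> :: nat \<Rightarrow> 'a set set. (\<forall>m. \<U> m \<in> \<A>) \<longrightarrow>
     (\<exists>T :: nat \<Rightarrow> 'a set set.
        (\<forall>m. disjoint (T m) \<and> (\<forall>V\<in>T m. \<exists>U\<in>\<U> m. V \<subseteq> U)) \<and> (\<Union>m. T m) \<in> \<B>))"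

definition S_fin :: "'a set set set \<Rightarrow> 'a set set set \<Rightarrow> bool" where
  "S_fin \<A> \<B> \<longleftrightarrow> (\<forall>\<U> :: nat \<Rightarrow> 'a set set. (\<forall>m. \<U> m \<in> \<A>) \<longrightarrow>
     (\<exists>T :: nat \<Rightarrow> 'a set set. (\<forall>m. finite (T m) \<and> T m \<subseteq> \<U> m) \<and> (\<Union>m. T m) \<in> \<B>))"

definition S_1 :: "'a set set set \<Rightarrow> 'a set set set \<Rightarrow> bool" where
  "S_1 \<A> \<B> \<longleftrightarrow> (\<forall>\<U> :: nat \<Rightarrow> 'a set set. (\<forall>m. \<U> m \<in> \<A>) \<longrightarrow>
     (\<exists>T :: nat \<Rightarrow> 'a set. (\<forall>m. T m \<in> \<U> m) \<and> range T \<in> \<B>))"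

text \<open>Ordinals are represented by (reflexive) well-orders and compared by \<open>\<le>o\<close> and \<open><o\<close>; the
  elements of \<open>Field \<alpha>\<close> are the innings of the game of length \<open>\<alpha>\<close>. A strategy \<open>F\<close> of TWO maps an
  inning \<open>\<gamma>\<close> and ONE's moves in all innings up to and including \<open>\<gamma>\<close> to TWO's move in inning \<open>\<gamma>\<close>;
  TWO's own earlier moves are determined by \<open>F\<close> and these data.\<close>

definition response ::
    "'i rel \<Rightarrow> ('i \<Rightarrow> ('i \<Rightarrow> 'a set set) \<Rightarrow> 'a set) \<Rightarrow> ('i \<Rightarrow> 'a set set) \<Rightarrow> 'i \<Rightarrow> 'a set" where
  "response \<alpha> F \<U> \<gamma> = F \<gamma> (restrict \<U> (under \<alpha> \<gamma>))"

definition TWO_wins_G1 :: "'i rel \<Rightarrow> 'a set set set \<Rightarrow> 'a set set set \<Rightarrow> bool" where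
  "TWO_wins_G1 \<alpha> \<A> \<B> \<longleftrightarrow>
     (\<exists>F. \<forall>\<U>. (\<forall>\<gamma>\<in>Field \<alpha>. \<U> \<gamma> \<in> \<A>) \<longrightarrow>
        (\<forall>\<gamma>\<in>Field \<alpha>. response \<alpha> F \<U> \<gamma> \<in> \<U> \<gamma>) \<and> response \<alpha> F \<U> ` Field \<alpha> \<in> \<B>)"

text \<open>\<open>is_tp_S1_OO X \<alpha>\<close>: the well-order \<open>\<alpha>\<close> represents the ordinal \<open>tp(X)\<close>. Letting \<open>\<beta>\<close> range over
  the well-orders on the same type loses nothing, as every ordinal below \<open>\<alpha>\<close> is represented by an
  initial segment of \<open>\<alpha>\<close>.\<close>

definition is_tp_S1_OO :: "'a topology \<Rightarrow> 'i rel \<Rightarrow> bool" where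
  "is_tp_S1_OO X \<alpha> \<longleftrightarrow> Well_order \<alpha> \<and> TWO_wins_G1 \<alpha> (open_covers X) (open_covers X) \<and>
     (\<forall>\<beta> :: 'i rel. Well_order \<beta> \<and> TWO_wins_G1 \<beta> (open_covers X) (open_covers X) \<longrightarrow> \<alpha> \<le>o \<beta>)"

text \<open>The ordinal power \<open>\<omega>\<^sup>2 = \<omega> \<cdot> \<omega>\<close>: the first component is the more significant one.\<close>

definition omega_squared :: "(nat \<times> nat) rel" where
  "omega_squared = {((a, b), (c, d)). a < c \<or> a = c \<and> b \<le> d}"

lemma Well_order_omega_squared: "Well_order omega_squared"
proof -
  have F: "Field omega_squared = UNIV"
    by (auto simp: omega_squared_def Field_def)
  have "omega_squared - Id = less_than <*lex*> less_than"
    by (auto simp: omega_squared_def)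
  then have "wf (omega_squared - Id)"
    by (simp add: wf_lex_prod)
  then show ?thesis
    unfolding F
    by (auto simp: well_order_on_def linear_order_on_def partial_order_on_def preorder_on_def
        refl_on_def trans_def antisym_def total_on_def omega_squared_def)
qed

end

theory Submission
  imports Defs
begin

text \<open>
  A winning strategy of TWO in a game of length below \<open>\<omega>\<^sup>2\<close> is turned into a covering
  property of \<open>X\<close> that does not mention games. For a fixed history, TWO's possible answers in
  one inning shrink to some point \<open>x\<close>: otherwise the neighbourhoods that contain no answer would
  form a cover to which TWO has no answer. In a first countable space, countably many covers suffice to
  force answers into all neighbourhoods of \<open>x\<close>. Thus the first \<open>\<omega>\<close> innings give a countable set \<open>C\<close>
  such that, for each open \<open>U \<supseteq> C\<close>, ONE can keep all of TWO's answers in these innings inside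
  \<open>U\<close>, and TWO has to cover \<open>X - U\<close> in the remaining ones. Iterating over the finitely many
  rows of innings yields \<open>iterated_concentrated\<close>: level \<open>0\<close> is the empty set, and \<open>A\<close> has level \<open>k + 1\<close> if some
  countable \<open>C\<close> exists such that \<open>A - U\<close> has level \<open>k\<close> for every open \<open>U \<supseteq> C\<close>.

  On the side of \<open>Y\<close>, groupability is used only through a Hurewicz-type property
  (\<open>Hurewicz_selection\<close>): from a sequence of stages of open covers one can select finitely many
  sets at each stage so that every point of \<open>Y\<close> is covered in almost every one of the blocks
  \<open>{k..<r k}\<close> of stages. The selection may be required to consist of finite, one-element or disjoint families,
  depending on the principle assumed.

  The two sides meet in \<open>cover_near_countable_set\<close>. Given open covers of \<open>X \<times> Y\<close>, one selects
  over the points of \<open>C\<close> finitely many tubes at each stage. A neighbourhood \<open>U\<close> of \<open>C\<close> for which the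
  selection covers \<open>U \<times> Y\<close> need not exist, because the tubes shrink from
  stage to stage. However, \<open>Y\<close> is a union of pieces \<open>E p\<close>, consisting of the points that are covered in
  every block from \<open>p\<close> on, and each piece has its own open set \<open>U p \<supseteq> C\<close> with \<open>U p \<times> E p\<close>
  covered. The rest of \<open>A \<times> Y\<close> lies in the union of the sets \<open>(A - U p) \<times> Y\<close>, whose first
  factors are one level lower, and countable unions cause no harm since a sequence of covers can be
  split into infinitely many sequences. Induction on the level finishes the proof, simultaneously for
  all three selection principles.
\<close>


section \<open>Games of length below \<open>\<omega>\<^sup>2\<close> and iterated concentration\<close>

text \<open>For points of a \<open>T\<^sub>1\<close>-space, level 1 means that \<open>A\<close> is countable, and level 2 that
  \<open>A\<close> is concentrated on a countable set in the classical sense: every open set containing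
  that set leaves only countably many points of \<open>A\<close> uncovered.\<close>

primrec iterated_concentrated :: "'a topology \<Rightarrow> nat \<Rightarrow> 'a set \<Rightarrow> bool" where
  "iterated_concentrated X 0 A \<longleftrightarrow> A = {}"
| "iterated_concentrated X (Suc k) A \<longleftrightarrow>
     (\<exists>C. countable C \<and> C \<subseteq> topspace X \<and>
        (\<forall>U. openin X U \<and> C \<subseteq> U \<longrightarrow> iterated_concentrated X k (A - U)))"

text \<open>A proper initial segment of \<open>\<omega>\<^sup>2\<close> meets only finitely many rows. Transporting the game to
  the pairs, with idle innings outside the initial segment, makes \<open>R p \<U>\<close> TWO's answer at \<open>p\<close>
  when \<open>\<U>\<close> is the full record of ONE's moves; this answer depends only on the moves up to \<open>p\<close>.\<close>

lemma TWO_wins_rows: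
  fixes X :: "'a topology" and \<alpha> :: "'i rel"
  assumes win: "TWO_wins_G1 \<alpha> (open_covers X) (open_covers X)" and less: "\<alpha> <o omega_squared"
  obtains R :: "nat \<times> nat \<Rightarrow> (nat \<times> nat \<Rightarrow> 'a set set) \<Rightarrow> 'a set" and a :: nat
  where "\<And>p \<U> \<U>'. (\<And>p'. (p', p) \<in> omega_squared \<Longrightarrow> \<U> p' = \<U>' p') \<Longrightarrow> R p \<U> = R p \<U>'"
    and "\<And>p \<U>. (\<And>p'. \<U> p' \<in> open_covers X) \<Longrightarrow> R p \<U> \<in> insert {} (\<U> p)"
    and "\<And>\<U>. (\<And>p'. \<U> p' \<in> open_covers X) \<Longrightarrow> topspace X \<subseteq> (\<Union>p\<in>{p. fst p < a}. R p \<U>)"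
proof -
  from less obtain f where wo: "Well_order \<alpha>" and emb: "embedS \<alpha> omega_squared f"
    unfolding ordLess_def by auto
  then have e: "embed \<alpha> omega_squared f"
    by (simp add: embedS_def)
  have inj: "inj_on f (Field \<alpha>)"
    by (rule embed_inj_on[OF wo e])
  have mono: "(f \<gamma>, f \<delta>) \<in> omega_squared" if "(\<gamma>, \<delta>) \<in> \<alpha>" for \<gamma> \<delta>
    using embed_compat[OF e] that by (auto simp: compat_def)
  obtain ab where ab: "ab \<notin> f ` Field \<alpha>"
    using embedS_Field[OF wo emb] by blast
  have bound: "fst (f \<gamma>) < Suc (fst ab)" if g: "\<gamma> \<in> Field \<alpha>" for \<gamma>
  proof (rule ccontr)
    assume "\<not> fst (f \<gamma>) < Suc (fst ab)"
    then have "ab \<in> under omega_squared (f \<gamma>)"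
      by (auto simp: under_def omega_squared_def case_prod_beta)
    also have "\<dots> = f ` under \<alpha> \<gamma>"
      using e g by (auto simp: embed_def bij_betw_def)
    also have "\<dots> \<subseteq> f ` Field \<alpha>"
      by (auto simp: under_def Field_def)
    finally show False using ab by simp
  qed
  from win obtain F where F: "\<And>\<U>. (\<forall>\<gamma>\<in>Field \<alpha>. \<U> \<gamma> \<in> open_covers X) \<Longrightarrow>
        (\<forall>\<gamma>\<in>Field \<alpha>. response \<alpha> F \<U> \<gamma> \<in> \<U> \<gamma>) \<and> response \<alpha> F \<U> ` Field \<alpha> \<in> open_covers X"
    unfolding TWO_wins_G1_def by auto
  (* Pairs that are not the image of an inning are skipped: TWO gets the empty set there. *)
  define R where "R p \<U> = (if p \<in> f ` Field \<alpha>
      then response \<alpha> F (\<lambda>\<gamma>. \<U> (f \<gamma>)) (inv_into (Field \<alpha>) f p) else {})" for p and \<U> :: "nat \<times> nat \<Rightarrow> 'a set set"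
  have R_f: "R (f \<gamma>) \<U> = response \<alpha> F (\<lambda>\<gamma>. \<U> (f \<gamma>)) \<gamma>" if "\<gamma> \<in> Field \<alpha>" for \<gamma> \<U>
    using that inj by (simp add: R_def)
  show thesis
  proof (rule that[of R "Suc (fst ab)"])
    fix p and \<U> \<U>' :: "nat \<times> nat \<Rightarrow> 'a set set"
    assume agree: "\<And>p'. (p', p) \<in> omega_squared \<Longrightarrow> \<U> p' = \<U>' p'"
    show "R p \<U> = R p \<U>'"
    proof (cases "p \<in> f ` Field \<alpha>")
      case True
      then obtain \<gamma> where g: "\<gamma> \<in> Field \<alpha>" "p = f \<gamma>" by auto
      have "restrict (\<lambda>\<gamma>. \<U> (f \<gamma>)) (under \<alpha> \<gamma>) = restrict (\<lambda>\<gamma>. \<U>' (f \<gamma>)) (under \<alpha> \<gamma>)"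
        by (rule restrict_ext) (simp add: under_def agree mono g)
      then show ?thesis
        using g by (simp add: R_f response_def)
    qed (simp add: R_def)
  next
    fix p and \<U> :: "nat \<times> nat \<Rightarrow> 'a set set"
    assume "\<And>p'. \<U> p' \<in> open_covers X"
    then show "R p \<U> \<in> insert {} (\<U> p)"
      using F[of "\<lambda>\<gamma>. \<U> (f \<gamma>)"] by (cases "p \<in> f ` Field \<alpha>") (auto simp: R_f, auto simp: R_def)
  next
    fix \<U> :: "nat \<times> nat \<Rightarrow> 'a set set"
    assume "\<And>p'. \<U> p' \<in> open_covers X"
    then have cov: "topspace X = \<Union> (response \<alpha> F (\<lambda>\<gamma>. \<U> (f \<gamma>)) ` Field \<alpha>)"
      using F[of "\<lambda>\<gamma>. \<U> (f \<gamma>)"] by (auto simp: open_covers_def)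
    show "topspace X \<subseteq> (\<Union>p\<in>{p. fst p < Suc (fst ab)}. R p \<U>)"
    proof
      fix x assume "x \<in> topspace X"
      then obtain \<gamma> where "\<gamma> \<in> Field \<alpha>" "x \<in> R (f \<gamma>) \<U>"
        unfolding cov by (auto simp: R_f)
      with bound show "x \<in> (\<Union>p\<in>{p. fst p < Suc (fst ab)}. R p \<U>)" by blast
    qed
  qed
qed

text \<open>Against a fixed history, TWO's answers in one inning can be forced to shrink to a point:
  if every point \<open>x\<close> had a neighbourhood \<open>V x\<close> containing no possible answer, then the answer
  to the cover by the sets \<open>V x\<close> would be one of these sets. First countability
  reduces the covers needed to a sequence.\<close>

lemma answers_shrink_to_point:
  fixes G :: "'a set set \<Rightarrow> 'a set"
  assumes fc: "first_countable X" and ne: "topspace X \<noteq> {}"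
    and G: "\<And>\<O>. \<O> \<in> open_covers X \<Longrightarrow> G \<O> \<in> insert {} \<O>"
  shows "\<exists>x \<O>. x \<in> topspace X \<and> (\<forall>n::nat. \<O> n \<in> open_covers X) \<and>
           (\<forall>U. openin X U \<and> x \<in> U \<longrightarrow> (\<exists>n. G (\<O> n) \<subseteq> U))"
proof -
  have "\<exists>x\<in>topspace X. \<forall>V. openin X V \<and> x \<in> V \<longrightarrow> (\<exists>\<O>\<in>open_covers X. G \<O> \<subseteq> V)"
  proof (rule ccontr)
    assume "\<not> ?thesis"
    then have "\<forall>x\<in>topspace X. \<exists>V. openin X V \<and> x \<in> V \<and> \<not> (\<exists>\<O>\<in>open_covers X. G \<O> \<subseteq> V)"
      by blast
    then obtain V where V: "\<And>x. x \<in> topspace X \<Longrightarrow>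
        openin X (V x) \<and> x \<in> V x \<and> \<not> (\<exists>\<O>\<in>open_covers X. G \<O> \<subseteq> V x)"
      by metis
    have cov: "V ` topspace X \<in> open_covers X"
      using V openin_subset by (fastforce simp: open_covers_def)
    then have "\<exists>x\<in>topspace X. G (V ` topspace X) \<subseteq> V x"
      using G[OF cov] ne by (metis empty_subsetI equals0I imageE insertE subset_refl)
    with V cov show False by blast
  qed
  then obtain x where x: "x \<in> topspace X"
      and sh: "\<And>V. openin X V \<Longrightarrow> x \<in> V \<Longrightarrow> \<exists>\<O>\<in>open_covers X. G \<O> \<subseteq> V"
    by blast
  obtain \<B> where \<B>: "countable \<B>" "\<And>V. V \<in> \<B> \<Longrightarrow> openin X V"
      "\<And>U. openin X U \<Longrightarrow> x \<in> U \<Longrightarrow> \<exists>V\<in>\<B>. x \<in> V \<and> V \<subseteq> U"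
    using fc x unfolding first_countable_def by metis
  define \<B>' where "\<B>' = {V \<in> \<B>. x \<in> V}"
  have "countable \<B>'" "\<B>' \<noteq> {}"
    using \<B>(1) \<B>(3)[OF openin_topspace x] by (auto simp: \<B>'_def)
  then have rng: "range (from_nat_into \<B>') = \<B>'"
    by simp
  have "\<forall>n. \<exists>\<O>. \<O> \<in> open_covers X \<and> G \<O> \<subseteq> from_nat_into \<B>' n"
    using sh \<B>(2) from_nat_into[OF \<open>\<B>' \<noteq> {}\<close>] unfolding \<B>'_def by blast
  then obtain \<O> where \<O>: "\<And>n. \<O> n \<in> open_covers X \<and> G (\<O> n) \<subseteq> from_nat_into \<B>' n"
    by metis
  have "\<exists>n. G (\<O> n) \<subseteq> U" if "openin X U" "x \<in> U" for U
  proof -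
    obtain V where "V \<in> \<B>'" "V \<subseteq> U"
      using \<B>(3)[of U] \<open>openin X U\<close> \<open>x \<in> U\<close> by (auto simp: \<B>'_def)
    moreover from this rng obtain n where "V = from_nat_into \<B>' n"
      by blast
    ultimately show ?thesis using \<O> by blast
  qed
  with x \<O> show ?thesis by blast
qed

text \<open>One row of innings. The points to which TWO's answers shrink, taken over the countable
  tree of histories in which ONE only uses the countably many covers of
  \<open>answers_shrink_to_point\<close>, form \<open>C\<close>. An open \<open>U \<supseteq> C\<close> picks out a branch of the tree along which all answers
  of the row lie in \<open>U\<close>, so that the remaining rows have to cover \<open>A - U\<close>.\<close>

lemma iterated_concentrated_of_rows:
  fixes X :: "'a topology" and R :: "nat \<times> nat \<Rightarrow> (nat \<times> nat \<Rightarrow> 'a set set) \<Rightarrow> 'a set"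
  assumes fc: "first_countable X" and ne: "topspace X \<noteq> {}"
    and R_cong: "\<And>p \<U> \<U>'. (\<And>p'. (p', p) \<in> omega_squared \<Longrightarrow> \<U> p' = \<U>' p') \<Longrightarrow> R p \<U> = R p \<U>'"
    and R_in: "\<And>p \<U>. (\<And>p'. \<U> p' \<in> open_covers X) \<Longrightarrow> R p \<U> \<in> insert {} (\<U> p)"
    and hist: "\<And>p. \<H> p \<in> open_covers X"
    and win: "\<And>\<U>. (\<And>p. \<U> p \<in> open_covers X) \<Longrightarrow> (\<And>p. fst p < q \<Longrightarrow> \<U> p = \<H> p) \<Longrightarrow>
                A \<subseteq> (\<Union>p\<in>{p. q \<le> fst p \<and> fst p < q + k}. R p \<U>)"
  shows "iterated_concentrated X k A"
  using hist win
proof (induction k arbitrary: q \<H> A)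
  case 0
  have "A \<subseteq> (\<Union>p\<in>{p. q \<le> fst p \<and> fst p < q + 0}. R p \<H>)"
    by (rule 0(2)) (simp_all add: 0(1))
  moreover have "{p::nat \<times> nat. q \<le> fst p \<and> fst p < q + 0} = {}"
    by auto
  ultimately show ?case by (metis UN_empty iterated_concentrated.simps(1) subset_empty)
next
  case (Suc k)
  note hist = Suc.prems(1) and win = Suc.prems(2)
  let ?covers = "\<lambda>\<U>::nat \<times> nat \<Rightarrow> 'a set set. \<forall>p. \<U> p \<in> open_covers X"
  have "\<exists>x \<O>. x \<in> topspace X \<and> (\<forall>n::nat. \<O> n \<in> open_covers X) \<and>
           (\<forall>U. openin X U \<and> x \<in> U \<longrightarrow> (\<exists>n. R p (\<U>(p := \<O> n)) \<subseteq> U))"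
    if "?covers \<U>" for p \<U>
  proof (rule answers_shrink_to_point[OF fc ne])
    fix \<O> assume "\<O> \<in> open_covers X"
    then show "R p (\<U>(p := \<O>)) \<in> insert {} \<O>"
      using R_in[of "\<U>(p := \<O>)" p] that by auto
  qed
  then have "\<forall>p \<U>. \<exists>x \<O>. ?covers \<U> \<longrightarrow> (x \<in> topspace X \<and> (\<forall>n::nat. \<O> n \<in> open_covers X) \<and>
           (\<forall>U. openin X U \<and> x \<in> U \<longrightarrow> (\<exists>n. R p (\<U>(p := \<O> n)) \<subseteq> U)))"
    by blast
  then obtain pt \<O> where pt: "\<And>p \<U>. ?covers \<U> \<Longrightarrow> pt p \<U> \<in> topspace X"
    and \<O>: "\<And>p \<U> n. ?covers \<U> \<Longrightarrow> \<O> p \<U> n \<in> open_covers X"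
    and near: "\<And>p \<U> U. ?covers \<U> \<Longrightarrow> openin X U \<Longrightarrow> pt p \<U> \<in> U \<Longrightarrow>
                 \<exists>n::nat. R p (\<U>(p := \<O> p \<U> n)) \<subseteq> U"
    by metis
  define hs where "hs = rec_nat {\<H>} (\<lambda>i H. (\<lambda>(\<U>, n). \<U>((q, i) := \<O> (q, i) \<U> n)) ` (H \<times> UNIV))"
  have hs_0: "hs 0 = {\<H>}"
    and hs_Suc: "hs (Suc i) = (\<lambda>(\<U>, n). \<U>((q, i) := \<O> (q, i) \<U> n)) ` (hs i \<times> UNIV)" for i
    by (simp_all add: hs_def)
  have hs_countable: "countable (hs i)" for i
    by (induction i) (simp_all add: hs_0 hs_Suc)
  have hs_covers: "?covers \<U>" if "\<U> \<in> hs i" for \<U> i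
    using that
  proof (induction i arbitrary: \<U>)
    case (Suc i)
    then obtain \<U>' n where "\<U>' \<in> hs i" "\<U> = \<U>'((q, i) := \<O> (q, i) \<U>' n)"
      by (auto simp: hs_Suc)
    with Suc.IH[of \<U>'] \<O>[of \<U>'] show ?case by simp
  qed (simp add: hs_0 hist)
  define C where "C = (\<Union>i. pt (q, i) ` hs i)"
  have "iterated_concentrated X k (A - U)" if U: "openin X U" "C \<subseteq> U" for U
  proof -
    have "\<exists>h. \<forall>i. h i \<in> hs i \<and> (i = 0 \<longrightarrow> h i = \<H>) \<and>
        ((\<exists>n. h (Suc i) = (h i)((q, i) := \<O> (q, i) (h i) n)) \<and> R (q, i) (h (Suc i)) \<subseteq> U)"
      unfolding conj_assoc[symmetric]
    proof (subst conj_assoc, rule dependent_nat_choice)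
      show "\<exists>\<U>. \<U> \<in> hs 0 \<and> (0 = (0::nat) \<longrightarrow> \<U> = \<H>)"
        by (simp add: hs_0)
    next
      fix \<U> i assume "\<U> \<in> hs i \<and> (i = 0 \<longrightarrow> \<U> = \<H>)"
      then have \<U>: "\<U> \<in> hs i" by simp
      then have "pt (q, i) \<U> \<in> U"
        using U(2) by (auto simp: C_def)
      from near[OF hs_covers[OF \<U>] U(1) this]
      obtain n where "R (q, i) (\<U>((q, i) := \<O> (q, i) \<U> n)) \<subseteq> U" ..
      moreover have "\<U>((q, i) := \<O> (q, i) \<U> n) \<in> hs (Suc i)"
        using \<U> by (auto simp: hs_Suc)
      ultimately show "\<exists>\<U>'. (\<U>' \<in> hs (Suc i) \<and> (Suc i = 0 \<longrightarrow> \<U>' = \<H>)) \<and>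
          (\<exists>n. \<U>' = \<U>((q, i) := \<O> (q, i) \<U> n)) \<and> R (q, i) \<U>' \<subseteq> U"
        by auto
    qed
    then obtain h where h: "\<And>i. h i \<in> hs i" "h 0 = \<H>"
        "\<And>i. \<exists>n. h (Suc i) = (h i)((q, i) := \<O> (q, i) (h i) n)"
        "\<And>i. R (q, i) (h (Suc i)) \<subseteq> U"
      by blast
    have h_other: "h i p = \<H> p" if "fst p \<noteq> q" for i p
      using that
    proof (induction i)
      case (Suc i)
      obtain n where "h (Suc i) = (h i)((q, i) := \<O> (q, i) (h i) n)" using h(3) by blast
      then have "h (Suc i) p = h i p" using Suc.prems by (metis fst_conv fun_upd_other)
      with Suc show ?case by simp
    qed (simp add: h(2))
    have h_stable: "h j (q, i) = h (Suc i) (q, i)" if "Suc i \<le> j" for i j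
      using that
    proof (induction j rule: dec_induct)
      case (step j)
      obtain n where "h (Suc j) = (h j)((q, j) := \<O> (q, j) (h j) n)" using h(3) by blast
      then have "h (Suc j) (q, i) = h j (q, i)" using step.hyps by simp
      with step.IH show ?case by simp
    qed simp
    (* The limit of the branch; no answer in the row depends on later rows. *)
    define \<H>' where "\<H>' p = (if fst p = q then h (Suc (snd p)) p else \<H> p)" for p
    have row: "R (q, i) \<H>' \<subseteq> U" for i
    proof -
      have "R (q, i) \<H>' = R (q, i) (h (Suc i))"
      proof (rule R_cong)
        fix p' assume "(p', (q, i)) \<in> omega_squared"
        then have "fst p' = q \<Longrightarrow> snd p' \<le> i" "fst p' \<le> q"
          by (auto simp: omega_squared_def)
        then show "\<H>' p' = h (Suc i) p'"
          using h_other h_stable[of "snd p'" "Suc i"]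
          by (cases p') (auto simp: \<H>'_def)
      qed
      with h(4) show ?thesis by simp
    qed
    show ?thesis
    proof (rule Suc.IH[of \<H>' "Suc q"])
      show "\<H>' p \<in> open_covers X" for p
      proof (cases "fst p = q")
        case True
        then show ?thesis using hs_covers[OF h(1), of "Suc (snd p)"] unfolding \<H>'_def by metis
      next
        case False
        then show ?thesis using hist unfolding \<H>'_def by metis
      qed
    next
      fix \<U> assume \<U>: "\<And>p. \<U> p \<in> open_covers X" and agree: "\<And>p. fst p < Suc q \<Longrightarrow> \<U> p = \<H>' p"
      have "\<U> p = \<H> p" if "fst p < q" for p
        using agree that by (simp add: \<H>'_def)
      then have "A \<subseteq> (\<Union>p\<in>{p. q \<le> fst p \<and> fst p < q + Suc k}. R p \<U>)"
        by (rule win[OF \<U>])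
      moreover have "R p \<U> \<subseteq> U" if "fst p = q" for p
      proof -
        have "R p \<U> = R p \<H>'"
          using that by (intro R_cong agree) (auto simp: omega_squared_def)
        then show ?thesis
          using that row[of "snd p"] by (cases p) auto
      qed
      ultimately show "A - U \<subseteq> (\<Union>p\<in>{p. Suc q \<le> fst p \<and> fst p < Suc q + k}. R p \<U>)"
      proof (intro subsetI)
        fix x assume x: "x \<in> A - U"
        then obtain p where p: "q \<le> fst p" "fst p < q + Suc k" "x \<in> R p \<U>"
          using \<open>A \<subseteq> _\<close> by blast
        moreover have "fst p \<noteq> q"
          using \<open>\<And>p. fst p = q \<Longrightarrow> R p \<U> \<subseteq> U\<close> p(3) x by blast
        ultimately have "p \<in> {p. Suc q \<le> fst p \<and> fst p < Suc q + k}" by simp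
        with p(3) show "x \<in> (\<Union>p\<in>{p. Suc q \<le> fst p \<and> fst p < Suc q + k}. R p \<U>)" by blast
      qed
    qed
  qed
  moreover have "countable C" "C \<subseteq> topspace X"
    using hs_countable pt hs_covers by (auto simp: C_def)
  ultimately show ?case by auto
qed

lemma iterated_concentrated_topspace:
  assumes "first_countable X"
    and "TWO_wins_G1 \<alpha> (open_covers X) (open_covers X)" and "\<alpha> <o omega_squared"
  obtains k where "iterated_concentrated X k (topspace X)"
proof (cases "topspace X = {}")
  case True
  then show thesis by (intro that[of 0]) simp
next
  case False
  show thesis
  proof (rule TWO_wins_rows[OF assms(2,3)])
    fix R :: "nat \<times> nat \<Rightarrow> (nat \<times> nat \<Rightarrow> 'a set set) \<Rightarrow> 'a set" and a :: nat
    assume R: "\<And>p \<U> \<U>'. (\<And>p'. (p', p) \<in> omega_squared \<Longrightarrow> \<U> p' = \<U>' p') \<Longrightarrow> R p \<U> = R p \<U>'"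
      "\<And>p \<U>. (\<And>p'. \<U> p' \<in> open_covers X) \<Longrightarrow> R p \<U> \<in> insert {} (\<U> p)"
      "\<And>\<U>. (\<And>p'. \<U> p' \<in> open_covers X) \<Longrightarrow> topspace X \<subseteq> (\<Union>p\<in>{p. fst p < a}. R p \<U>)"
    have "iterated_concentrated X a (topspace X)"
    proof (rule iterated_concentrated_of_rows[where R = R and q = 0 and \<H> = "\<lambda>_. {topspace X}"])
      show "{topspace X} \<in> open_covers X"
        by (simp add: open_covers_def)
    next
      fix \<U> :: "nat \<times> nat \<Rightarrow> 'a set set"
      assume "\<And>p. \<U> p \<in> open_covers X"
      from R(3)[OF this] show "topspace X \<subseteq> (\<Union>p\<in>{p. 0 \<le> fst p \<and> fst p < 0 + a}. R p \<U>)"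
        by simp
    next
      fix p and \<U> \<U>' :: "nat \<times> nat \<Rightarrow> 'a set set"
      assume "\<And>p'. (p', p) \<in> omega_squared \<Longrightarrow> \<U> p' = \<U>' p'"
      then show "R p \<U> = R p \<U>'" by (rule R(1))
    next
      fix p and \<U> :: "nat \<times> nat \<Rightarrow> 'a set set"
      assume "\<And>p. \<U> p \<in> open_covers X"
      then show "R p \<U> \<in> insert {} (\<U> p)" by (rule R(2))
    qed (fact assms(1) False)+
    then show thesis by (rule that)
  qed
qed

section \<open>The Hurewicz property\<close>

text \<open>With \<open>Q\<close> meaning finite or one-element, \<open>principle\<close> becomes \<open>S_fin\<close> or
  \<open>S_1\<close> for \<open>\<omega>\<close>-covers and groupable covers. The families \<open>\<V> n\<close> may contain the
  whole space; if that happens infinitely often, one selects it. Otherwise, the partition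
  witnessing that the selected cover is groupable is translated into intervals \<open>{k..<r k}\<close> of indices:
  a late enough group only involves sets selected after stage \<open>k\<close>, because each of the finitely
  many sets selected before belongs to only one group.\<close>

lemma groupable_selection_intervals:
  fixes Y :: "'b topology" and Q :: "'b set set \<Rightarrow> bool"
  assumes Q_finite: "\<And>T. Q T \<Longrightarrow> finite T" and Q_singleton: "\<And>V. Q {V}"
    and principle: "\<forall>\<V> :: nat \<Rightarrow> 'b set set. (\<forall>n. \<V> n \<in> omega_covers Y) \<longrightarrow>
          (\<exists>T. (\<forall>n. Q (T n) \<and> T n \<subseteq> \<V> n) \<and> (\<Union>n. T n) \<in> groupable_covers Y)"
    and \<V>_open: "\<forall>n. \<forall>V\<in>\<V> n. openin Y V"
    and \<V>_omega: "\<And>n F. finite F \<Longrightarrow> F \<subseteq> topspace Y \<Longrightarrow> \<exists>V\<in>\<V> n. F \<subseteq> V"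
  shows "\<exists>T (r :: nat \<Rightarrow> nat). (\<forall>n. Q (T n) \<and> T n \<subseteq> \<V> n) \<and>
    (\<forall>y\<in>topspace Y. \<forall>\<^sub>F k in sequentially. \<exists>n\<in>{k..<r k}. y \<in> \<Union>(T n))" (is "\<exists>T r. ?P T r")
proof -
  have "\<forall>n. \<exists>V. V \<in> \<V> n"
    using \<V>_omega[of "{}"] by blast
  then obtain V0 where V0: "\<And>n. V0 n \<in> \<V> n" by metis
  show ?thesis
  proof (cases "\<exists>N. \<forall>n\<ge>N. topspace Y \<notin> \<V> n")
    case False
    then have "\<forall>k. \<exists>n\<ge>k. topspace Y \<in> \<V> n" by blast
    then obtain g where g: "\<And>k. g k \<ge> k" "\<And>k. topspace Y \<in> \<V> (g k)" by metis
    define T where "T n = {if topspace Y \<in> \<V> n then topspace Y else V0 n}" for n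
    have "\<forall>n. Q (T n) \<and> T n \<subseteq> \<V> n"
      using V0 Q_singleton by (simp add: T_def)
    moreover have "\<exists>n\<in>{k..<Suc (g k)}. y \<in> \<Union>(T n)" if "y \<in> topspace Y" for y k
      using that g by (intro bexI[of _ "g k"]) (auto simp: T_def)
    ultimately show ?thesis
      by (intro exI[of _ T] exI[of _ "\<lambda>k. Suc (g k)"]) (auto intro: always_eventually)
  next
    case True
    then obtain N where N: "\<And>n. topspace Y \<notin> \<V> (n + N)" by (meson le_add2)
    have "\<V> (n + N) \<in> omega_covers Y" for n
      unfolding omega_covers_def open_covers_def
    proof (intro CollectI conjI)
      show "\<Union>(\<V> (n + N)) = topspace Y"
        using \<V>_open openin_subset \<V>_omega[of "{_}"] by fastforce
    qed (use \<V>_open \<V>_omega N in auto)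
    then obtain T where T: "\<And>n. Q (T n)" "\<And>n. T n \<subseteq> \<V> (n + N)" "(\<Union>n. T n) \<in> groupable_covers Y"
      using principle[rule_format, of "\<lambda>n. \<V> (n + N)"] by blast
    from T(3) obtain \<G> :: "nat \<Rightarrow> 'b set set" where \<G>: "(\<Union>n. T n) = (\<Union>k. \<G> k)" "disjoint_family \<G>"
        "\<And>k. finite (\<G> k)" and \<G>_cofin: "\<And>y. y \<in> topspace Y \<Longrightarrow> finite {k. y \<notin> \<Union>(\<G> k)}"
      unfolding groupable_covers_def by auto
    have "\<forall>V\<in>(\<Union>n. T n). \<exists>n. V \<in> T n" by blast
    then obtain stage where stage: "\<And>V. V \<in> (\<Union>n. T n) \<Longrightarrow> V \<in> T (stage V)" by metis
    have late: "\<exists>j\<ge>k. \<forall>V\<in>\<G> j. k \<le> stage V" for k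
    proof -
      have "finite {j. V \<in> \<G> j}" for V
        using \<G>(2) by (rule_tac finite_subset[of _ "{SOME j. V \<in> \<G> j}"])
          (auto simp: disjoint_family_on_def intro: someI2)
      then have "finite (\<Union>n\<in>{..<k}. \<Union>V\<in>T n. {j. V \<in> \<G> j})"
        using T(1) Q_finite by blast
      then have "finite ({..<k} \<union> (\<Union>n\<in>{..<k}. \<Union>V\<in>T n. {j. V \<in> \<G> j}))" by simp
      then obtain j where j: "j \<notin> {..<k} \<union> (\<Union>n\<in>{..<k}. \<Union>V\<in>T n. {j. V \<in> \<G> j})"
        using ex_new_if_finite infinite_UNIV_nat by blast
      have "k \<le> stage V" if "V \<in> \<G> j" for V
        using j that stage[of V] \<G>(1) by (force simp: not_le[symmetric])
      with j show ?thesis by (intro exI[of _ j]) auto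
    qed
    then obtain g where g: "\<And>k. g k \<ge> k" "\<And>k V. V \<in> \<G> (g k) \<Longrightarrow> k \<le> stage V" by metis
    define T' where "T' n = (if n < N then {V0 n} else T (n - N))" for n
    define r where "r k = (\<Sum>V\<in>\<G> (g k). Suc (stage V + N))" for k
    have "\<forall>n. Q (T' n) \<and> T' n \<subseteq> \<V> n"
    proof
      fix n show "Q (T' n) \<and> T' n \<subseteq> \<V> n"
        using T(1) T(2)[of "n - N"] V0 Q_singleton by (auto simp: T'_def)
    qed
    moreover have "\<forall>\<^sub>F k in sequentially. \<exists>n\<in>{k..<r k}. y \<in> \<Union>(T' n)"
      if y: "y \<in> topspace Y" for y
    proof -
      obtain K where K: "\<And>k. k \<ge> K \<Longrightarrow> y \<in> \<Union>(\<G> k)"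
        using \<G>_cofin[OF y]
        by (metis (mono_tags, lifting) finite_nat_set_iff_bounded leD mem_Collect_eq)
      have "\<exists>n\<in>{k..<r k}. y \<in> \<Union>(T' n)" if k: "k \<ge> K" for k
      proof -
        obtain V where V: "V \<in> \<G> (g k)" "y \<in> V"
          using K[of "g k"] g(1)[of k] k by auto
        have "V \<in> T (stage V)" using stage V(1) \<G>(1) by blast
        then have "y \<in> \<Union>(T' (stage V + N))" using V by (auto simp: T'_def)
        moreover have "Suc (stage V + N) \<le> r k"
          unfolding r_def by (rule member_le_sum[OF V(1)]) (simp_all add: \<G>(3))
        ultimately show ?thesis
          using g(2)[OF V(1)] by (intro bexI[of _ "stage V + N"]) auto
      qed
      then show ?thesis
        using eventually_sequentially by blast
    qed
    ultimately show ?thesis by blast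
  qed
qed

text \<open>A stage \<open>n\<close> is a whole sequence of covers \<open>\<U> n i\<close>: the sets that a one-element or disjoint
  selection takes from a single cover need not contain a prescribed finite set in their union,
  but finitely many such selections from different covers can. The blocks \<open>{k..<r k}\<close> replace
  the single stages of the usual Hurewicz property, because groups of selected sets may spread over
  several stages.\<close>

definition Hurewicz_selection :: "'b topology \<Rightarrow> ('b set set \<Rightarrow> 'b set set \<Rightarrow> bool) \<Rightarrow> bool" where
  "Hurewicz_selection Y sel \<longleftrightarrow>
     (\<forall>\<U>. (\<forall>n i. \<U> n i \<in> open_covers Y) \<longrightarrow>
        (\<exists>(S :: nat \<Rightarrow> nat \<Rightarrow> 'b set set) r.
           (\<forall>n i. sel (\<U> n i) (S n i)) \<and> (\<forall>n. finite (SIGMA i:UNIV. S n i)) \<and>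
           (\<forall>y\<in>topspace Y. \<forall>\<^sub>F k in sequentially. \<exists>n\<in>{k..<r k}. \<exists>i. y \<in> \<Union>(S n i))))"

definition finite_selection :: "'c set set \<Rightarrow> 'c set set \<Rightarrow> bool" where
  "finite_selection \<O> T \<longleftrightarrow> finite T \<and> T \<subseteq> \<O>"

definition single_selection :: "'c set set \<Rightarrow> 'c set set \<Rightarrow> bool" where
  "single_selection \<O> T \<longleftrightarrow> T \<subseteq> \<O> \<and> (\<exists>V. T \<subseteq> {V})"

definition disjoint_selection :: "'c topology \<Rightarrow> 'c set set \<Rightarrow> 'c set set \<Rightarrow> bool" where
  "disjoint_selection Z \<O> T \<longleftrightarrow>
     disjoint T \<and> (\<forall>V\<in>T. openin Z V) \<and> (\<forall>V\<in>T. \<exists>U\<in>\<O>. V \<subseteq> U)"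

text \<open>The \<open>\<omega>\<close>-covers to use are those by finite unions.\<close>

lemma S_fin_omega_groupable_imp_Hurewicz:
  assumes S: "S_fin (omega_covers Y) (groupable_covers Y)"
    and \<U>: "\<And>n::nat. \<U> n \<in> open_covers Y"
  shows "\<exists>D (r :: nat \<Rightarrow> nat). (\<forall>n. finite (D n) \<and> D n \<subseteq> \<U> n) \<and>
    (\<forall>y\<in>topspace Y. \<forall>\<^sub>F k in sequentially. \<exists>n\<in>{k..<r k}. y \<in> \<Union>(D n))"
proof -
  define \<V> where "\<V> n = {\<Union>D | D. finite D \<and> D \<subseteq> \<U> n}" for n
  have omega: "\<exists>V\<in>\<V> n. F \<subseteq> V" if F: "finite F" "F \<subseteq> topspace Y" for n F
  proof -
    have "F \<subseteq> \<Union>(\<U> n)" using F \<U>[of n] by (auto simp: open_covers_def)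
    then obtain D where "D \<subseteq> \<U> n" "finite D" "F \<subseteq> \<Union>D"
      using finite_subset_Union[OF F(1)] by metis
    then show ?thesis by (auto simp: \<V>_def)
  qed
  have opn: "\<forall>n. \<forall>V\<in>\<V> n. openin Y V"
    using \<U> by (auto simp: \<V>_def open_covers_def intro!: openin_Union)
  obtain T and r :: "nat \<Rightarrow> nat" where T: "\<forall>n. finite (T n) \<and> T n \<subseteq> \<V> n"
    and r: "\<forall>y\<in>topspace Y. \<forall>\<^sub>F k in sequentially. \<exists>n\<in>{k..<r k}. y \<in> \<Union>(T n)"
    using groupable_selection_intervals[where Q = finite and \<V> = \<V>, OF _ _ S[unfolded S_fin_def] opn omega] by auto
  have "\<forall>n. \<exists>D. finite D \<and> D \<subseteq> \<U> n \<and> \<Union>(T n) = \<Union>D"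
  proof
    fix n
    have "\<forall>V\<in>T n. \<exists>D. finite D \<and> D \<subseteq> \<U> n \<and> \<Union>D = V"
      using T[rule_format, of n] by (auto simp: \<V>_def)
    then obtain d where d: "\<And>V. V \<in> T n \<Longrightarrow> finite (d V) \<and> d V \<subseteq> \<U> n \<and> \<Union>(d V) = V" by metis
    have "\<Union>(T n) = (\<Union>V\<in>T n. \<Union>(d V))" using d by simp
    also have "\<dots> = \<Union>(\<Union>(d ` T n))" by blast
    finally have "\<Union>(T n) = \<Union>(\<Union>(d ` T n))" .
    moreover have "finite (\<Union>(d ` T n))" "\<Union>(d ` T n) \<subseteq> \<U> n"
      using T d by auto
    ultimately show "\<exists>D. finite D \<and> D \<subseteq> \<U> n \<and> \<Union>(T n) = \<Union>D" by blast
  qed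
  then obtain D where "\<And>n. finite (D n) \<and> D n \<subseteq> \<U> n \<and> \<Union>(T n) = \<Union>(D n)" by metis
  with r show ?thesis by (intro exI[of _ D] exI[of _ r]) simp
qed

lemma Hurewicz_finite_selection:
  assumes "S_fin (omega_covers Y) (groupable_covers Y)"
  shows "Hurewicz_selection Y finite_selection"
  unfolding Hurewicz_selection_def
proof (intro allI impI)
  fix \<U> :: "nat \<Rightarrow> nat \<Rightarrow> 'a set set"
  assume "\<forall>n i. \<U> n i \<in> open_covers Y"
  then obtain D and r :: "nat \<Rightarrow> nat" where D: "\<forall>n. finite (D n) \<and> D n \<subseteq> \<U> n 0"
    and r: "\<forall>y\<in>topspace Y. \<forall>\<^sub>F k in sequentially. \<exists>n\<in>{k..<r k}. y \<in> \<Union>(D n)"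
    using S_fin_omega_groupable_imp_Hurewicz[of Y "\<lambda>n. \<U> n 0", OF assms] \<open>\<forall>n i. _\<close> by auto
  define S where "S n i = (if i = 0 then D n else {})" for n and i :: nat
  have "(SIGMA i:UNIV. S n i) = {0} \<times> D n" for n
    by (auto simp: S_def split: if_splits)
  then have fin: "finite (SIGMA i:UNIV. S n i)" for n using D by simp
  have D_eq: "(\<exists>i. y \<in> \<Union>(S n i)) \<longleftrightarrow> y \<in> \<Union>(D n)" for y n
    by (auto simp: S_def split: if_splits)
  show "\<exists>S r. (\<forall>n i. finite_selection (\<U> n i) (S n i)) \<and> (\<forall>n. finite (SIGMA i:UNIV. S n i)) \<and>
       (\<forall>y\<in>topspace Y. \<forall>\<^sub>F k in sequentially. \<exists>n\<in>{k..<r k}. \<exists>i. y \<in> \<Union>(S n i))"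
    using fin D r by (intro exI[of _ S] exI[of _ r]) (simp add: D_eq del: Union_iff, simp add: S_def finite_selection_def)
qed

text \<open>The members of the families given by \<open>S_c\<close> at stage \<open>n\<close> form a cover; the
  finite subset selected from this cover is split up again among these families.\<close>

lemma Hurewicz_disjoint_selection:
  assumes Sc: "S_c (open_covers Y) (open_covers Y)"
    and Sfin: "S_fin (omega_covers Y) (groupable_covers Y)"
  shows "Hurewicz_selection Y (disjoint_selection Y)"
  unfolding Hurewicz_selection_def
proof (intro allI impI)
  fix \<U> :: "nat \<Rightarrow> nat \<Rightarrow> 'a set set"
  assume \<U>: "\<forall>n i. \<U> n i \<in> open_covers Y"
  have "\<forall>n. \<exists>P. (\<forall>i. disjoint (P i) \<and> (\<forall>V\<in>P i. \<exists>U\<in>\<U> n i. V \<subseteq> U)) \<and> (\<Union>i. P i) \<in> open_covers Y"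
    using Sc \<U> unfolding S_c_def by blast
  then obtain P where P: "\<And>n i. disjoint (P n i)" "\<And>n i V. V \<in> P n i \<Longrightarrow> \<exists>U\<in>\<U> n i. V \<subseteq> U"
      "\<And>n. (\<Union>i. P n i) \<in> open_covers Y"
    by metis
  obtain D and r :: "nat \<Rightarrow> nat" where D: "\<forall>n. finite (D n) \<and> D n \<subseteq> (\<Union>i. P n i)"
    and r: "\<forall>y\<in>topspace Y. \<forall>\<^sub>F k in sequentially. \<exists>n\<in>{k..<r k}. y \<in> \<Union>(D n)"
    using S_fin_omega_groupable_imp_Hurewicz[of Y "\<lambda>n. \<Union>i. P n i", OF Sfin P(3)] by auto
  have "\<forall>n. \<forall>V\<in>D n. \<exists>i. V \<in> P n i" using D by blast
  then obtain \<iota> where \<iota>: "\<And>n V. V \<in> D n \<Longrightarrow> V \<in> P n (\<iota> n V)" by metis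
  define S where "S n i = {V \<in> D n. \<iota> n V = i}" for n i
  have S_P: "S n i \<subseteq> P n i" for n i using \<iota> by (auto simp: S_def)
  have "(SIGMA i:UNIV. S n i) = (\<lambda>V. (\<iota> n V, V)) ` D n" for n by (auto simp: S_def)
  then have fin: "finite (SIGMA i:UNIV. S n i)" for n using D by simp
  have sel: "disjoint_selection Y (\<U> n i) (S n i)" for n i
    unfolding disjoint_selection_def
    using S_P[of n i] P(1)[of n i] P(2)[of _ n i] P(3)[of n]
    by (auto simp: open_covers_def intro: pairwise_subset)
  have D_eq: "(\<exists>i. y \<in> \<Union>(S n i)) \<longleftrightarrow> y \<in> \<Union>(D n)" for y n
    by (auto simp: S_def)
  show "\<exists>S r. (\<forall>n i. disjoint_selection Y (\<U> n i) (S n i)) \<and> (\<forall>n. finite (SIGMA i:UNIV. S n i)) \<and>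
       (\<forall>y\<in>topspace Y. \<forall>\<^sub>F k in sequentially. \<exists>n\<in>{k..<r k}. \<exists>i. y \<in> \<Union>(S n i))"
    using fin sel r by (intro exI[of _ S] exI[of _ r]) (simp add: D_eq del: Union_iff)
qed

text \<open>Here the \<open>\<omega>\<close>-cover used at stage \<open>n\<close> consists of the unions of one set from each of the first
  \<open>l\<close> covers of the stage, with \<open>l\<close> arbitrary.\<close>

lemma Hurewicz_single_selection:
  assumes S1: "S_1 (omega_covers Y) (groupable_covers Y)"
  shows "Hurewicz_selection Y single_selection"
  unfolding Hurewicz_selection_def
proof (intro allI impI)
  fix \<U> :: "nat \<Rightarrow> nat \<Rightarrow> 'a set set"
  assume \<U>: "\<forall>n i. \<U> n i \<in> open_covers Y"
  define \<V> where "\<V> n = {\<Union>i<l. W i | (l::nat) W. \<forall>i<l. W i \<in> \<U> n i}" for n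
  have omega: "\<exists>V\<in>\<V> n. F \<subseteq> V" if F: "finite F" "F \<subseteq> topspace Y" for n F
  proof -
    obtain e where e: "bij_betw e {..<card F} F"
      using ex_bij_betw_nat_finite[OF F(1)] by (auto simp: lessThan_atLeast0)
    have "\<forall>i<card F. \<exists>W. W \<in> \<U> n i \<and> e i \<in> W"
    proof (intro allI impI)
      fix i assume "i < card F"
      then have "e i \<in> \<Union>(\<U> n i)"
        using e F(2) \<U> by (auto simp: open_covers_def bij_betw_def)
      then show "\<exists>W. W \<in> \<U> n i \<and> e i \<in> W" by blast
    qed
    then obtain W where W: "\<And>i. i < card F \<Longrightarrow> W i \<in> \<U> n i \<and> e i \<in> W i" by metis
    have "(\<Union>i<card F. W i) \<in> \<V> n" using W unfolding \<V>_def by blast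
    moreover have "F \<subseteq> (\<Union>i<card F. W i)"
    proof
      fix y assume "y \<in> F"
      then obtain i where "i < card F" "y = e i" using e by (auto simp: bij_betw_def)
      with W show "y \<in> (\<Union>i<card F. W i)" by blast
    qed
    ultimately show ?thesis by blast
  qed
  have opn: "\<forall>n. \<forall>V\<in>\<V> n. openin Y V"
    using \<U> by (auto simp: \<V>_def open_covers_def intro!: openin_Union)
  have principle: "\<forall>\<W> :: nat \<Rightarrow> 'a set set. (\<forall>n. \<W> n \<in> omega_covers Y) \<longrightarrow>
      (\<exists>T. (\<forall>n. (\<exists>V. T n = {V}) \<and> T n \<subseteq> \<W> n) \<and> (\<Union>n. T n) \<in> groupable_covers Y)"
  proof (intro allI impI)
    fix \<W> :: "nat \<Rightarrow> 'a set set"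
    assume "\<forall>n. \<W> n \<in> omega_covers Y"
    then obtain t where "\<And>n. t n \<in> \<W> n" "range t \<in> groupable_covers Y"
      using S1 unfolding S_1_def by metis
    then show "\<exists>T. (\<forall>n. (\<exists>V. T n = {V}) \<and> T n \<subseteq> \<W> n) \<and> (\<Union>n. T n) \<in> groupable_covers Y"
      by (intro exI[of _ "\<lambda>n. {t n}"]) (auto simp: UNION_singleton_eq_range)
  qed
  have fin: "finite T" if "\<exists>V. T = {V}" for T :: "'a set set"
    using that by auto
  obtain T and r :: "nat \<Rightarrow> nat" where T: "\<forall>n. (\<exists>V. T n = {V}) \<and> T n \<subseteq> \<V> n"
    and r: "\<forall>y\<in>topspace Y. \<forall>\<^sub>F k in sequentially. \<exists>n\<in>{k..<r k}. y \<in> \<Union>(T n)"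
    using groupable_selection_intervals[where Q = "\<lambda>T. \<exists>V. T = {V}" and \<V> = \<V>, OF fin _ principle opn omega] by auto
  have "\<forall>n. \<exists>l W. \<Union>(T n) = (\<Union>i<l. W i) \<and> (\<forall>i<l. W i \<in> \<U> n i)"
  proof
    fix n
    obtain V where "T n = {V}" "V \<in> \<V> n" using T[rule_format, of n] by auto
    then show "\<exists>l W. \<Union>(T n) = (\<Union>i<l. W i) \<and> (\<forall>i<l. W i \<in> \<U> n i)"
      by (auto simp: \<V>_def)
  qed
  then obtain l :: "nat \<Rightarrow> nat" and W
    where W: "\<And>n. \<Union>(T n) = (\<Union>i<l n. W n i)" "\<And>n i. i < l n \<Longrightarrow> W n i \<in> \<U> n i"
    by metis
  define S where "S n i = (if i < l n then {W n i} else {})" for n i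
  have "(SIGMA i:UNIV. S n i) = (\<lambda>i. (i, W n i)) ` {..<l n}" for n
    by (auto simp: S_def split: if_splits)
  then have fin: "finite (SIGMA i:UNIV. S n i)" for n by simp
  have sel: "single_selection (\<U> n i) (S n i)" for n i
    using W(2) by (auto simp: S_def single_selection_def)
  have T_eq: "(\<exists>i. y \<in> \<Union>(S n i)) \<longleftrightarrow> y \<in> \<Union>(T n)" for y n
    unfolding W(1) by (auto simp: S_def split: if_splits)
  show "\<exists>S r. (\<forall>n i. single_selection (\<U> n i) (S n i)) \<and> (\<forall>n. finite (SIGMA i:UNIV. S n i)) \<and>
       (\<forall>y\<in>topspace Y. \<forall>\<^sub>F k in sequentially. \<exists>n\<in>{k..<r k}. \<exists>i. y \<in> \<Union>(S n i))"
    using fin sel r by (intro exI[of _ S] exI[of _ r]) (simp add: T_eq del: Union_iff)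
qed

section \<open>Selecting covers of products\<close>

definition selectable ::
    "('c set set \<Rightarrow> 'c set set \<Rightarrow> bool) \<Rightarrow> 'c topology \<Rightarrow> 'c set \<Rightarrow> bool" where
  "selectable sel Z B \<longleftrightarrow>
     (\<forall>\<O> :: nat \<Rightarrow> 'c set set. (\<forall>m. \<O> m \<in> open_covers Z) \<longrightarrow>
        (\<exists>T. (\<forall>m. sel (\<O> m) (T m)) \<and> B \<subseteq> (\<Union>m. \<Union>(T m))))"

lemma selectable_UN:
  fixes B :: "nat \<Rightarrow> 'c set"
  assumes "\<And>p. selectable sel Z (B p)"
  shows "selectable sel Z (\<Union>p. B p)"
  unfolding selectable_def
proof (intro allI impI)
  fix \<O> :: "nat \<Rightarrow> 'c set set"
  assume \<O>: "\<forall>m. \<O> m \<in> open_covers Z"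
  have "\<exists>T. (\<forall>m. sel (\<O> (prod_encode (p, m))) (T m)) \<and> B p \<subseteq> (\<Union>m. \<Union>(T m))" for p
    by (rule assms[of p, unfolded selectable_def, rule_format]) (simp add: \<O>)
  then obtain T where T: "\<And>p m. sel (\<O> (prod_encode (p, m))) (T p m)" "\<And>p. B p \<subseteq> (\<Union>m. \<Union>(T p m))"
    by metis
  define T' where "T' k = T (fst (prod_decode k)) (snd (prod_decode k))" for k
  have "sel (\<O> k) (T' k)" for k
    using T(1)[of "fst (prod_decode k)" "snd (prod_decode k)"] by (simp add: T'_def)
  moreover have "(\<Union>p. B p) \<subseteq> (\<Union>k. \<Union>(T' k))"
  proof (rule UN_least)
    fix p
    have "\<Union>(T p m) \<subseteq> (\<Union>k. \<Union>(T' k))" for m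
      by (rule SUP_upper2[of "prod_encode (p, m)"]) (simp_all add: T'_def)
    with T(2)[of p] show "B p \<subseteq> (\<Union>k. \<Union>(T' k))" by blast
  qed
  ultimately show "\<exists>T. (\<forall>k. sel (\<O> k) (T k)) \<and> (\<Union>p. B p) \<subseteq> (\<Union>k. \<Union>(T k))" by blast
qed

lemma finite_tube:
  assumes "finite I" and "c \<in> topspace X"
    and "\<And>i. i \<in> I \<Longrightarrow> \<exists>V. openin X V \<and> c \<in> V \<and> V \<times> W i \<subseteq> G"
  shows "\<exists>V. openin X V \<and> c \<in> V \<and> V \<times> (\<Union>i\<in>I. W i) \<subseteq> G"
  using assms(1,3)
proof (induction I)
  case empty
  then show ?case using assms(2) by (intro exI[of _ "topspace X"]) simp
next
  case (insert i I)
  obtain V V' where "openin X V" "c \<in> V" "V \<times> (\<Union>i\<in>I. W i) \<subseteq> G"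
      "openin X V'" "c \<in> V'" "V' \<times> W i \<subseteq> G"
    using insert.IH insert.prems by (metis insertI1 insertI2)
  then show ?case by (intro exI[of _ "V \<inter> V'"]) auto
qed

text \<open>What the three notions of selection share: a selection \<open>S\<close> among open sets of \<open>Y\<close> that have a
  tube over a fixed point \<open>c\<close> inside a member of a cover \<open>\<O>\<close> of the product lifts to a selection \<open>T\<close>
  from \<open>\<O>\<close> that contains such a tube for every member of \<open>S\<close>.\<close>

locale product_selection =
  fixes X :: "'a topology" and Y :: "'b topology"
    and sel :: "('a \<times> 'b) set set \<Rightarrow> ('a \<times> 'b) set set \<Rightarrow> bool"
    and selY :: "'b set set \<Rightarrow> 'b set set \<Rightarrow> bool"
  assumes sel_empty: "\<And>\<O>. sel \<O> {}"
    and sel_lift: "\<And>c \<U> S \<O>. selY \<U> S \<Longrightarrow>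
          \<forall>W\<in>\<U>. \<exists>V H. openin X V \<and> c \<in> V \<and> H \<in> \<O> \<and> V \<times> W \<subseteq> H \<Longrightarrow>
          \<exists>T. sel \<O> T \<and> (\<forall>W\<in>S. \<exists>V. openin X V \<and> c \<in> V \<and> V \<times> W \<subseteq> \<Union>T)"
    and Hurewicz: "Hurewicz_selection Y selY"
begin

text \<open>The key step. At stage \<open>n\<close> the sets chosen in \<open>Y\<close> have tubes over each of the first \<open>n + 1\<close>
  points of \<open>C\<close>. The tubes shrink as \<open>n\<close> grows, so a single neighbourhood of \<open>C\<close> need not work
  for all of \<open>Y\<close>. The piece \<open>E p\<close> consists of the points of \<open>Y\<close> covered by every block
  \<open>{k..<r k}\<close> of stages with \<open>k \<ge> p\<close>; since a block is finite, its tubes over one point of \<open>C\<close> have a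
  common base.\<close>

lemma cover_near_countable_set:
  fixes \<O> :: "nat \<Rightarrow> ('a \<times> 'b) set set"
  assumes C: "countable C" "C \<subseteq> topspace X"
    and \<O>: "\<And>m. \<O> m \<in> open_covers (prod_topology X Y)"
  shows "\<exists>T U (E :: nat \<Rightarrow> 'b set). (\<forall>m. sel (\<O> m) (T m)) \<and> (\<forall>p. openin X (U p) \<and> C \<subseteq> U p) \<and>
           topspace Y \<subseteq> (\<Union>p. E p) \<and> (\<forall>p. U p \<times> E p \<subseteq> (\<Union>m. \<Union>(T m)))"
proof (cases "C = {}")
  case True
  then show ?thesis
    using sel_empty
    by (intro exI[of _ "\<lambda>_. {}"] exI[of _ "\<lambda>_. topspace Y"]) auto
next
  case False
  then obtain c :: "nat \<Rightarrow> 'a" where c: "C = range c"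
    using C(1) by (metis range_from_nat_into)
  then have c_top: "c j \<in> topspace X" for j using C(2) by auto
  define \<O>3 where "\<O>3 n i j = \<O> (prod_encode (n, prod_encode (i, j)))" for n i j
  have \<O>3_box: "\<exists>V W H. openin X V \<and> openin Y W \<and> x \<in> V \<and> y \<in> W \<and> H \<in> \<O>3 n i j \<and> V \<times> W \<subseteq> H"
    if "x \<in> topspace X" "y \<in> topspace Y" for x y n i j
  proof -
    have cov: "\<Union>(\<O>3 n i j) = topspace X \<times> topspace Y"
        "\<And>H. H \<in> \<O>3 n i j \<Longrightarrow> openin (prod_topology X Y) H"
      using \<O> by (auto simp: \<O>3_def open_covers_def)
    then obtain H where "H \<in> \<O>3 n i j" "(x, y) \<in> H" using \<open>x \<in> _\<close> \<open>y \<in> _\<close> by blast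
    with cov(2)[of H] show ?thesis unfolding openin_prod_topology_alt by metis
  qed
  define \<U> where "\<U> n i = {W. openin Y W \<and>
      (\<forall>j\<le>n. \<exists>V H. openin X V \<and> c j \<in> V \<and> H \<in> \<O>3 n i j \<and> V \<times> W \<subseteq> H)}" for n i
  have \<U>_mem: "\<exists>W\<in>\<U> n i. y \<in> W" if "y \<in> topspace Y" for y n i
  proof -
    have "\<forall>j. \<exists>W. openin Y W \<and> y \<in> W \<and>
        (\<exists>V H. openin X V \<and> c j \<in> V \<and> H \<in> \<O>3 n i j \<and> V \<times> W \<subseteq> H)"
      using \<O>3_box[OF c_top that] by meson
    then obtain w where w: "\<And>j. openin Y (w j)" "\<And>j. y \<in> w j"
        "\<And>j. \<exists>V H. openin X V \<and> c j \<in> V \<and> H \<in> \<O>3 n i j \<and> V \<times> w j \<subseteq> H"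
      by metis
    have "openin Y (\<Inter>j\<in>{..n}. w j)" using w(1) by (intro openin_INT2) auto
    moreover have "\<exists>V H. openin X V \<and> c j \<in> V \<and> H \<in> \<O>3 n i j \<and> V \<times> (\<Inter>j\<in>{..n}. w j) \<subseteq> H"
      if "j \<le> n" for j
    proof -
      have "(\<Inter>j\<in>{..n}. w j) \<subseteq> w j" using that by auto
      then show ?thesis using w(3)[of j] by (meson Sigma_mono order_refl subset_trans)
    qed
    ultimately show ?thesis using w(2) by (intro bexI[of _ "\<Inter>j\<in>{..n}. w j"]) (auto simp: \<U>_def)
  qed
  have "\<U> n i \<in> open_covers Y" for n i
  proof -
    have "\<forall>W\<in>\<U> n i. openin Y W" by (simp add: \<U>_def)
    then show ?thesis using \<U>_mem[of _ n i] openin_subset by (fastforce simp: open_covers_def)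
  qed
  then obtain S and r :: "nat \<Rightarrow> nat" where S: "\<forall>n i. selY (\<U> n i) (S n i)"
      and S_fin: "\<forall>n. finite (SIGMA i:UNIV. S n i)"
      and r: "\<forall>y\<in>topspace Y. \<forall>\<^sub>F k in sequentially. \<exists>n\<in>{k..<r k}. \<exists>i. y \<in> \<Union>(S n i)"
    using Hurewicz[unfolded Hurewicz_selection_def, rule_format, of \<U>] by blast
  have "\<exists>T. sel (\<O>3 n i j) T \<and>
          (j \<le> n \<longrightarrow> (\<forall>W\<in>S n i. \<exists>V. openin X V \<and> c j \<in> V \<and> V \<times> W \<subseteq> \<Union>T))" for n i j
  proof (cases "j \<le> n")
    case True
    then have "\<forall>W\<in>\<U> n i. \<exists>V H. openin X V \<and> c j \<in> V \<and> H \<in> \<O>3 n i j \<and> V \<times> W \<subseteq> H"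
      by (simp add: \<U>_def)
    from sel_lift[OF S[rule_format] this] show ?thesis by blast
  qed (use sel_empty in auto)
  then obtain T3 where T3: "\<And>n i j. sel (\<O>3 n i j) (T3 n i j)"
      and tube: "\<And>n i j W. j \<le> n \<Longrightarrow> W \<in> S n i \<Longrightarrow>
                   \<exists>V. openin X V \<and> c j \<in> V \<and> V \<times> W \<subseteq> \<Union>(T3 n i j)"
    by metis
  define T where "T m = (let (n, ij) = prod_decode m; (i, j) = prod_decode ij in T3 n i j)" for m
  have T_enc: "T (prod_encode (n, prod_encode (i, j))) = T3 n i j" for n i j
    by (simp add: T_def)
  have T_sel: "sel (\<O> m) (T m)" for m
  proof -
    obtain n i j where "m = prod_encode (n, prod_encode (i, j))"
      by (metis prod_decode_inverse surj_pair)
    then show ?thesis using T3[of n i j] by (simp add: T_enc \<O>3_def)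
  qed
  let ?G = "\<Union>m. \<Union>(T m)"
  have T3_G: "\<Union>(T3 n i j) \<subseteq> ?G" for n i j
    by (rule SUP_upper2[of "prod_encode (n, prod_encode (i, j))"]) (simp_all add: T_enc)
  define I where "I k = (SIGMA n:{k..<r k}. SIGMA i:UNIV. S n i)" for k
  have I_fin: "finite (I k)" for k
    unfolding I_def by (rule finite_SigmaI) (use S_fin in blast)+
  have "\<exists>V. openin X V \<and> c j \<in> V \<and> V \<times> (\<Union>t\<in>I k. snd (snd t)) \<subseteq> ?G" if "j \<le> k" for j k
  proof (rule finite_tube[OF I_fin c_top])
    fix t assume "t \<in> I k"
    then obtain n i W where t: "t = (n, i, W)" "k \<le> n" "W \<in> S n i" by (auto simp: I_def)
    then obtain V where "openin X V" "c j \<in> V" "V \<times> W \<subseteq> \<Union>(T3 n i j)"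
      using tube[of j n W i] \<open>j \<le> k\<close> by auto
    with T3_G[of n i j] show "\<exists>V. openin X V \<and> c j \<in> V \<and> V \<times> snd (snd t) \<subseteq> ?G"
      by (intro exI[of _ V]) (auto simp: t(1))
  qed
  then obtain N where N: "\<And>j k. j \<le> k \<Longrightarrow> openin X (N j k)" "\<And>j k. j \<le> k \<Longrightarrow> c j \<in> N j k"
      "\<And>j k. j \<le> k \<Longrightarrow> N j k \<times> (\<Union>t\<in>I k. snd (snd t)) \<subseteq> ?G"
    by metis
  define U where "U p = (\<Union>k\<in>{p..}. \<Union>j\<in>{..k}. N j k)" for p
  define E where "E p = {y. \<forall>k\<ge>p. y \<in> (\<Union>t\<in>I k. snd (snd t))}" for p
  have U_open: "openin X (U p)" for p
    unfolding U_def using N(1) by (intro openin_Union) auto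
  have U_C: "C \<subseteq> U p" for p
  proof
    fix x assume "x \<in> C"
    then obtain j where "x = c j" using c by blast
    with N(2)[of j "max j p"] show "x \<in> U p" unfolding U_def by force
  qed
  have E_Y: "topspace Y \<subseteq> (\<Union>p. E p)"
  proof
    fix y assume "y \<in> topspace Y"
    with r obtain p where p: "\<forall>k\<ge>p. \<exists>n\<in>{k..<r k}. \<exists>i. y \<in> \<Union>(S n i)"
      unfolding eventually_sequentially by blast
    have "y \<in> (\<Union>t\<in>I k. snd (snd t))" if "k \<ge> p" for k
    proof -
      obtain n i W where "n \<in> {k..<r k}" "W \<in> S n i" "y \<in> W" using p \<open>k \<ge> p\<close> by blast
      then show ?thesis by (intro UN_I[of "(n, i, W)"]) (auto simp: I_def)
    qed
    then show "y \<in> (\<Union>p. E p)" by (auto simp: E_def)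
  qed
  have U_E: "U p \<times> E p \<subseteq> ?G" for p
  proof clarify
    fix x y assume "x \<in> U p" "y \<in> E p"
    then obtain k j where "k \<ge> p" "j \<le> k" "x \<in> N j k" "y \<in> (\<Union>t\<in>I k. snd (snd t))"
      by (auto simp: U_def E_def)
    with N(3)[of j k] show "(x, y) \<in> ?G" by blast
  qed
  show ?thesis
    using T_sel U_open U_C E_Y U_E by blast
qed

text \<open>Half of the covers are used near the countable set \<open>C\<close>. What is left over lies in the
  union of the sets \<open>(A - U p) \<times> topspace Y\<close>, whose first factors are one level lower.\<close>

lemma selectable_iterated_concentrated:
  assumes "iterated_concentrated X k A"
  shows "selectable sel (prod_topology X Y) (A \<times> topspace Y)"
  using assms
proof (induction k arbitrary: A)
  case 0
  then show ?case using sel_empty by (auto simp: selectable_def intro!: exI[of _ "\<lambda>_. {}"])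
next
  case (Suc k)
  then obtain C where C: "countable C" "C \<subseteq> topspace X"
      and lower: "\<And>U. openin X U \<Longrightarrow> C \<subseteq> U \<Longrightarrow> iterated_concentrated X k (A - U)"
    by auto
  show ?case
    unfolding selectable_def
  proof (intro allI impI)
    fix \<O> :: "nat \<Rightarrow> ('a \<times> 'b) set set"
    assume \<O>: "\<forall>m. \<O> m \<in> open_covers (prod_topology X Y)"
    then have "\<And>m. \<O> (2 * m) \<in> open_covers (prod_topology X Y)" by blast
    from cover_near_countable_set[of C "\<lambda>m. \<O> (2 * m)", OF C this]
    obtain T U and E :: "nat \<Rightarrow> 'b set" where T: "\<forall>m. sel (\<O> (2 * m)) (T m)"
        and U: "\<forall>p. openin X (U p) \<and> C \<subseteq> U p" and E: "topspace Y \<subseteq> (\<Union>p. E p)"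
        and UE: "\<forall>p. U p \<times> E p \<subseteq> (\<Union>m. \<Union>(T m))"
      by (elim exE conjE)
    have rest: "selectable sel (prod_topology X Y) (\<Union>p. (A - U p) \<times> topspace Y)"
      using U by (intro selectable_UN Suc.IH lower) auto
    have "\<exists>T. (\<forall>m. sel (\<O> (Suc (2 * m))) (T m)) \<and>
        (\<Union>p. (A - U p) \<times> topspace Y) \<subseteq> (\<Union>m. \<Union>(T m))"
      by (rule rest[unfolded selectable_def, rule_format]) (use \<O> in blast)
    then obtain T' where T': "\<forall>m. sel (\<O> (Suc (2 * m))) (T' m)"
        "(\<Union>p. (A - U p) \<times> topspace Y) \<subseteq> (\<Union>m. \<Union>(T' m))"
      by blast
    define S where "S m = (if even m then T (m div 2) else T' (m div 2))" for m
    have S_sel: "sel (\<O> m) (S m)" for m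
    proof (cases "even m")
      case True
      then show ?thesis using T[rule_format, of "m div 2"] by (simp add: S_def)
    next
      case False
      then show ?thesis using T'(1)[rule_format, of "m div 2"] by (simp add: S_def)
    qed
    have "T m = S (2 * m)" "T' m = S (Suc (2 * m))" for m
      by (simp_all add: S_def)
    then have G: "(\<Union>m. \<Union>(T m)) \<subseteq> (\<Union>m. \<Union>(S m))" "(\<Union>m. \<Union>(T' m)) \<subseteq> (\<Union>m. \<Union>(S m))"
      by auto
    have "A \<times> topspace Y \<subseteq> (\<Union>m. \<Union>(T m)) \<union> (\<Union>m. \<Union>(T' m))"
    proof clarify
      fix x y assume x: "x \<in> A" and y: "y \<in> topspace Y" and not_T': "(x, y) \<notin> (\<Union>m. \<Union>(T' m))"
      obtain p where "y \<in> E p" using E y by blast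
      moreover have "x \<in> U p" using T'(2) x y not_T' by blast
      ultimately show "(x, y) \<in> (\<Union>m. \<Union>(T m))" using UE by blast
    qed
    also have "\<dots> \<subseteq> (\<Union>m. \<Union>(S m))" using G by (rule Un_least)
    finally show "\<exists>T. (\<forall>m. sel (\<O> m) (T m)) \<and> A \<times> topspace Y \<subseteq> (\<Union>m. \<Union>(T m))"
      using S_sel by (intro exI[of _ S] conjI allI)
  qed
qed

end

section \<open>The three selection principles\<close>

lemma product_selection_finite:
  assumes "S_fin (omega_covers Y) (groupable_covers Y)"
  shows "product_selection (X :: 'a topology) (Y :: 'b topology) finite_selection finite_selection"
proof
  fix c :: 'a and \<U> S :: "'b set set" and \<O> :: "('a \<times> 'b) set set"
  assume S: "finite_selection \<U> S"
    and "\<forall>W\<in>\<U>. \<exists>V H. openin X V \<and> c \<in> V \<and> H \<in> \<O> \<and> V \<times> W \<subseteq> H"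
  then have "\<forall>W\<in>S. \<exists>V H. openin X V \<and> c \<in> V \<and> H \<in> \<O> \<and> V \<times> W \<subseteq> H"
    by (auto simp: finite_selection_def)
  then obtain V H where VH: "\<And>W. W \<in> S \<Longrightarrow> openin X (V W) \<and> c \<in> V W \<and> H W \<in> \<O> \<and> V W \<times> W \<subseteq> H W"
    by metis
  have "finite_selection \<O> (H ` S)"
    using S VH by (auto simp: finite_selection_def)
  moreover have "\<forall>W\<in>S. \<exists>V. openin X V \<and> c \<in> V \<and> V \<times> W \<subseteq> \<Union>(H ` S)"
  proof
    fix W assume "W \<in> S"
    then have "V W \<times> W \<subseteq> \<Union>(H ` S)"
      using VH by (intro order_trans[OF _ Union_upper[of "H W"]]) auto
    with VH[OF \<open>W \<in> S\<close>] show "\<exists>V. openin X V \<and> c \<in> V \<and> V \<times> W \<subseteq> \<Union>(H ` S)"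
      by (intro exI[of _ "V W"]) simp
  qed
  ultimately show "\<exists>T. finite_selection \<O> T \<and> (\<forall>W\<in>S. \<exists>V. openin X V \<and> c \<in> V \<and> V \<times> W \<subseteq> \<Union>T)"
    by blast
qed (use Hurewicz_finite_selection[OF assms] in \<open>simp_all add: finite_selection_def\<close>)

lemma product_selection_single:
  assumes "S_1 (omega_covers Y) (groupable_covers Y)"
  shows "product_selection (X :: 'a topology) (Y :: 'b topology) single_selection single_selection"
proof
  fix c :: 'a and \<U> S :: "'b set set" and \<O> :: "('a \<times> 'b) set set"
  assume S: "single_selection \<U> S"
    and tubes: "\<forall>W\<in>\<U>. \<exists>V H. openin X V \<and> c \<in> V \<and> H \<in> \<O> \<and> V \<times> W \<subseteq> H"
  show "\<exists>T. single_selection \<O> T \<and> (\<forall>W\<in>S. \<exists>V. openin X V \<and> c \<in> V \<and> V \<times> W \<subseteq> \<Union>T)"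
  proof (cases "S = {}")
    case True
    then show ?thesis by (intro exI[of _ "{}"]) (simp add: single_selection_def)
  next
    case False
    then obtain W where W: "S = {W}" "W \<in> \<U>"
      using S by (auto simp: single_selection_def subset_singleton_iff)
    then obtain V H where "openin X V" "c \<in> V" "H \<in> \<O>" "V \<times> W \<subseteq> H"
      using tubes by blast
    then show ?thesis
      using W(1) by (intro exI[of _ "{H}"]) (auto simp: single_selection_def)
  qed
qed (use Hurewicz_single_selection[OF assms] in \<open>simp_all add: single_selection_def\<close>)

text \<open>Here the selected family consists of the tubes themselves: tubes over disjoint sets
  are disjoint.\<close>

lemma product_selection_disjoint:
  assumes "S_c (open_covers Y) (open_covers Y)"
    and "S_fin (omega_covers Y) (groupable_covers Y)"
  shows "product_selection (X :: 'a topology) (Y :: 'b topology) (disjoint_selection (prod_topology X Y)) (disjoint_selection Y)"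
proof
  fix c :: 'a and \<U> S :: "'b set set" and \<O> :: "('a \<times> 'b) set set"
  assume S: "disjoint_selection Y \<U> S"
    and tubes: "\<forall>W\<in>\<U>. \<exists>V H. openin X V \<and> c \<in> V \<and> H \<in> \<O> \<and> V \<times> W \<subseteq> H"
  have "\<forall>W\<in>S. \<exists>V. openin X V \<and> c \<in> V \<and> (\<exists>H\<in>\<O>. V \<times> W \<subseteq> H)"
  proof
    fix W assume "W \<in> S"
    then obtain W' where W': "W' \<in> \<U>" "W \<subseteq> W'"
      using S by (auto simp: disjoint_selection_def)
    from bspec[OF tubes W'(1)]
    obtain V H where VH: "openin X V" "c \<in> V" "H \<in> \<O>" "V \<times> W' \<subseteq> H"
      by (elim exE conjE)
    have "V \<times> W \<subseteq> H"
      using Sigma_mono[OF order_refl W'(2)] VH(4) by (rule order_trans)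
    with VH show "\<exists>V. openin X V \<and> c \<in> V \<and> (\<exists>H\<in>\<O>. V \<times> W \<subseteq> H)"
      by (intro exI[of _ V] conjI bexI[of _ H])
  qed
  then obtain V where V: "\<And>W. W \<in> S \<Longrightarrow> openin X (V W) \<and> c \<in> V W \<and> (\<exists>H\<in>\<O>. V W \<times> W \<subseteq> H)"
    by metis
  let ?T = "(\<lambda>W. V W \<times> W) ` S"
  have "disjoint ?T"
  proof (rule pairwiseI)
    fix A B assume "A \<in> ?T" "B \<in> ?T" "A \<noteq> B"
    then obtain W W' where W: "A = V W \<times> W" "B = V W' \<times> W'" "W \<in> S" "W' \<in> S" "W \<noteq> W'"
      by blast
    then have "W \<inter> W' = {}"
      using S by (auto simp: disjoint_selection_def pairwise_def disjnt_def)
    then show "disjnt A B" unfolding W disjnt_def by blast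
  qed
  moreover have "openin (prod_topology X Y) (V W \<times> W)" if "W \<in> S" for W
    using V[OF that] S that by (simp add: disjoint_selection_def openin_prod_Times_iff)
  ultimately have "disjoint_selection (prod_topology X Y) \<O> ?T"
    using V by (auto simp: disjoint_selection_def)
  moreover have "\<forall>W\<in>S. \<exists>V. openin X V \<and> c \<in> V \<and> V \<times> W \<subseteq> \<Union>?T"
  proof
    fix W assume "W \<in> S"
    then have "V W \<times> W \<subseteq> \<Union>?T" by (intro Union_upper imageI)
    with V[OF \<open>W \<in> S\<close>] show "\<exists>V. openin X V \<and> c \<in> V \<and> V \<times> W \<subseteq> \<Union>?T"
      by (intro exI[of _ "V W"]) simp
  qed
  ultimately show "\<exists>T. disjoint_selection (prod_topology X Y) \<O> T \<and>
      (\<forall>W\<in>S. \<exists>V. openin X V \<and> c \<in> V \<and> V \<times> W \<subseteq> \<Union>T)"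
    by blast
qed (use Hurewicz_disjoint_selection[OF assms] in \<open>simp_all add: disjoint_selection_def\<close>)

lemma UN_in_open_covers:
  assumes "\<And>m V. V \<in> T m \<Longrightarrow> openin Z V" and "topspace Z \<subseteq> (\<Union>m. \<Union>(T m))"
  shows "(\<Union>m. T m) \<in> open_covers Z"
proof -
  have "openin Z V" if "V \<in> (\<Union>m. T m)" for V
    using assms(1) that by blast
  then have "\<Union>(\<Union>m. T m) \<subseteq> topspace Z"
    by (intro Union_least openin_subset)
  moreover have "topspace Z \<subseteq> \<Union>(\<Union>m. T m)"
    using assms(2) by blast
  ultimately have "\<Union>(\<Union>m. T m) = topspace Z"
    by (rule subset_antisym)
  with assms(1) show ?thesis by (auto simp: open_covers_def)
qed

lemma S_fin_of_selectable:
  assumes "selectable finite_selection Z (topspace Z)"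
  shows "S_fin (open_covers Z) (open_covers Z)"
  unfolding S_fin_def
proof (intro allI impI)
  fix \<O> :: "nat \<Rightarrow> 'a set set"
  assume \<O>: "\<forall>m. \<O> m \<in> open_covers Z"
  then obtain T where T: "\<forall>m. finite_selection (\<O> m) (T m)" "topspace Z \<subseteq> (\<Union>m. \<Union>(T m))"
    using assms unfolding selectable_def by blast
  have "openin Z V" if "V \<in> T m" for V m
  proof -
    have "V \<in> \<O> m" using T(1) that unfolding finite_selection_def by blast
    then show ?thesis using \<O> unfolding open_covers_def by blast
  qed
  then have "(\<Union>m. T m) \<in> open_covers Z"
    by (rule UN_in_open_covers[OF _ T(2)])
  with T(1) show "\<exists>T. (\<forall>m. finite (T m) \<and> T m \<subseteq> \<O> m) \<and> (\<Union>m. T m) \<in> open_covers Z"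
    unfolding finite_selection_def by blast
qed

lemma S_c_of_selectable:
  assumes "selectable (disjoint_selection Z) Z (topspace Z)"
  shows "S_c (open_covers Z) (open_covers Z)"
  unfolding S_c_def
proof (intro allI impI)
  fix \<O> :: "nat \<Rightarrow> 'a set set"
  assume "\<forall>m. \<O> m \<in> open_covers Z"
  then obtain T where T: "\<forall>m. disjoint_selection Z (\<O> m) (T m)" "topspace Z \<subseteq> (\<Union>m. \<Union>(T m))"
    using assms unfolding selectable_def by blast
  have "(\<Union>m. T m) \<in> open_covers Z"
    using T(1) by (intro UN_in_open_covers T(2)) (auto simp: disjoint_selection_def)
  with T(1) show "\<exists>T. (\<forall>m. disjoint (T m) \<and> (\<forall>V\<in>T m. \<exists>U\<in>\<O> m. V \<subseteq> U)) \<and> (\<Union>m. T m) \<in> open_covers Z"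
    unfolding disjoint_selection_def by blast
qed

text \<open>A cover of a nonempty space has a member, which replaces an empty selection.\<close>

lemma S_1_of_selectable:
  assumes "selectable single_selection Z (topspace Z)" and ne: "topspace Z \<noteq> {}"
  shows "S_1 (open_covers Z) (open_covers Z)"
  unfolding S_1_def
proof (intro allI impI)
  fix \<O> :: "nat \<Rightarrow> 'a set set"
  assume \<O>: "\<forall>m. \<O> m \<in> open_covers Z"
  then obtain T where T: "\<forall>m. single_selection (\<O> m) (T m)" "topspace Z \<subseteq> (\<Union>m. \<Union>(T m))"
    using assms(1) unfolding selectable_def by blast
  have "\<exists>V. V \<in> \<O> m \<and> T m \<subseteq> {V}" for m
  proof (cases "T m = {}")
    case True
    have "\<Union>(\<O> m) \<noteq> {}" using \<O> ne unfolding open_covers_def by blast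
    then have "\<O> m \<noteq> {}" by blast
    with True show ?thesis by blast
  next
    case False
    then show ?thesis using T(1) by (fastforce simp: single_selection_def)
  qed
  then obtain t where t: "\<And>m. t m \<in> \<O> m" "\<And>m. T m \<subseteq> {t m}" by metis
  have "(\<Union>m. \<Union>(T m)) \<subseteq> (\<Union>m. \<Union>{t m})"
    by (intro UN_mono Union_mono t(2) order_refl)
  with T(2) have "topspace Z \<subseteq> (\<Union>m. \<Union>{t m})"
    by (rule order_trans)
  moreover have "openin Z (t m)" for m
    using \<O>[rule_format, of m] t(1)[of m] by (auto simp: open_covers_def)
  ultimately have "(\<Union>m. {t m}) \<in> open_covers Z"
    by (intro UN_in_open_covers) auto
  then show "\<exists>T. (\<forall>m. T m \<in> \<O> m) \<and> range T \<in> open_covers Z"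
    using t(1) by (intro exI[of _ t]) (simp add: UNION_singleton_eq_range)
qed

theorem theorem11:
  fixes X :: "'a topology" and Y :: "'b topology" and \<alpha> :: "'i rel"
  assumes "metrizable_space X" and "separable_space X"
    and "metrizable_space Y" and "separable_space Y"
    and "is_tp_S1_OO X \<alpha>" and "\<alpha> <o omega_squared"
  shows "(S_c (open_covers Y) (open_covers Y) \<and> S_fin (omega_covers Y) (groupable_covers Y) \<longrightarrow>
            S_c (open_covers (prod_topology X Y)) (open_covers (prod_topology X Y))) \<and>
         (S_fin (omega_covers Y) (groupable_covers Y) \<longrightarrow>
            S_fin (open_covers (prod_topology X Y)) (open_covers (prod_topology X Y))) \<and>
         (topspace X \<noteq> {} \<and> topspace Y \<noteq> {} \<and> S_1 (omega_covers Y) (groupable_covers Y) \<longrightarrow>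
            S_1 (open_covers (prod_topology X Y)) (open_covers (prod_topology X Y)))"
proof -
  let ?Z = "prod_topology X Y"
  have "TWO_wins_G1 \<alpha> (open_covers X) (open_covers X)"
    using assms(5) by (simp add: is_tp_S1_OO_def)
  then obtain k where "iterated_concentrated X k (topspace X)"
    using iterated_concentrated_topspace[OF metrizable_imp_first_countable[OF assms(1)] _ assms(6)]
    by blast
  then have selectable: "selectable sel ?Z (topspace ?Z)" if "product_selection X Y sel selY" for sel selY
    using product_selection.selectable_iterated_concentrated[OF that] by simp
  have 1: "S_c (open_covers ?Z) (open_covers ?Z)"
    if "S_c (open_covers Y) (open_covers Y)" "S_fin (omega_covers Y) (groupable_covers Y)"
    by (rule S_c_of_selectable, rule selectable, rule product_selection_disjoint[OF that])
  have 2: "S_fin (open_covers ?Z) (open_covers ?Z)" if "S_fin (omega_covers Y) (groupable_covers Y)"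
    by (rule S_fin_of_selectable, rule selectable, rule product_selection_finite[OF that])
  have 3: "S_1 (open_covers ?Z) (open_covers ?Z)"
    if "topspace X \<noteq> {}" "topspace Y \<noteq> {}" "S_1 (omega_covers Y) (groupable_covers Y)"
  proof (rule S_1_of_selectable)
    show "selectable single_selection ?Z (topspace ?Z)"
      by (rule selectable, rule product_selection_single[OF that(3)])
    show "topspace ?Z \<noteq> {}"
      using that(1,2) unfolding topspace_prod_topology by blast
  qed
  from 1 2 3 show ?thesis by blast
qed

end
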